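(* Let $X$ be a reflexive Banach space and let $L:X\times X^*\to\mathbb{R}$ be an anti-selfdual Lagrangian such that for every $p\in X^*$ the function $x\mapsto L(x,p)$ is bounded on the bounded sets of $X$. Let $A:D(A)\subset X\to X^*$ be skew-adjoint modulo the boundary operators $(b_1,b_2):D(b_1,b_2)\subset X\to H_1\times H_2$, where $H_1,H_2$ are Hilbert spaces. Then the Lagrangian on $X\times X^*$ defined by $$M(x,p)=\begin{cases} L(x,Ax+p)+\frac12\|b_1(x)\|_{H_1}^2+\frac12\|b_2(x)\|_{H_2}^2 & \text{if } x\in D(A)\cap D(b_1,b_2),\\ +\infty & \text{if } x\notin D(A)\cap D(b_1,b_2)\end{cases}$$ is anti-selfdual on $X$.
   Context: All spaces are real. A convex Lagrangian on a reflexive Banach space $X$ is a convex lower semi-continuous function $L:X\times X^*\to\mathbb{R}\cup\{+\infty\}$ that is not identically $+\infty$. Its Legendre–Fenchel dual is $L^*(q,y)=\sup\{\langle q,x\rangle+\langle y,p\rangle-L(x,p):x\in X,\ p\in X^*\}$ for $(q,y)\in X^*\times X$. $L$ is anti-selfdual (ASD) on $X$ if $L^*(p,x)=L(-x,-p)$ for all $(p,x)\in X^*\times X$. Let $A$ be a linear (possibly unbounded) map from its domain $D(A)\subset X$ into $X^*$, and let $(b_1,b_2)$ be a pair of linear maps from a domain $D(b_1,b_2)\subset X$ into $H_1\times H_2$. $A$ is skew-adjoint modulo the boundary operators $(b_1,b_2)$ if: (1) $S:=D(A)\cap D(b_1,b_2)$ is dense in $X$; (2) $X_0:=\mathrm{Ker}(b_1,b_2)\cap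 D(A)$ is dense in $X$; (3) the image of $S$ by $(b_1,b_2)$ is dense in $H_1\times H_2$; (4) an element $y\in X$ belongs to $S$ if and only if $\sup\{\langle y,Ax\rangle-\frac12(\|b_1(x)\|_{H_1}^2+\|b_2(x)\|_{H_2}^2): x\in S,\ \|x\|_X<1\}<\infty$; (5) for all $x,y\in S$, $\langle y,Ax\rangle=-\langle Ay,x\rangle+\langle b_1(x),b_1(y)\rangle_{H_1}-\langle b_2(x),b_2(y)\rangle_{H_2}$. *)

theory Defs
  imports "HOL-Analysis.Analysis"
begin

type_synonym 'a dual = "'a \<Rightarrow>\<^sub>L real"

(* The canonical embedding into the bidual is onto. *)
definition reflexive_space :: "'a::banach itself \<Rightarrow> bool" where
  "reflexive_space _ \<longleftrightarrow>
     (\<forall>\<phi> :: 'a dual dual. \<exists>x::'a. \<forall>f. blinfun_apply \<phi> f = blinfun_apply f x)"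

(* Since ereal has 0 * \<infinity> = 0, the endpoints u = 0 and v = 0 impose nothing.  The inequality
   is the usual one for functions avoiding -\<infinity>, the only ones it is applied to here. *)
definition ereal_convex :: "('a::real_vector \<Rightarrow> ereal) \<Rightarrow> bool" where
  "ereal_convex f \<longleftrightarrow>
     (\<forall>x y. \<forall>u\<ge>0. \<forall>v\<ge>0. u + v = 1 \<longrightarrow>
        f (u *\<^sub>R x + v *\<^sub>R y) \<le> ereal u * f x + ereal v * f y)"

definition lower_semicontinuous :: "('a::topological_space \<Rightarrow> ereal) \<Rightarrow> bool" where
  "lower_semicontinuous f \<longleftrightarrow> (\<forall>x. f x \<le> Liminf (at x) f)"

definition convex_lagrangian :: "('a::banach \<times> 'a dual \<Rightarrow> ereal) \<Rightarrow> bool" where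
  "convex_lagrangian L \<longleftrightarrow>
     (\<forall>z. L z \<noteq> -\<infinity>) \<and> (\<exists>z. L z \<noteq> \<infinity>) \<and> ereal_convex L \<and> lower_semicontinuous L"

definition legendre_dual :: "('a::banach \<times> 'a dual \<Rightarrow> ereal) \<Rightarrow> 'a dual \<times> 'a \<Rightarrow> ereal" where
  "legendre_dual L = (\<lambda>(q, y).
     SUP (x, p)\<in>UNIV. ereal (blinfun_apply q x + blinfun_apply p y) - L (x, p))"

definition anti_selfdual :: "('a::banach \<times> 'a dual \<Rightarrow> ereal) \<Rightarrow> bool" where
  "anti_selfdual L \<longleftrightarrow>
     convex_lagrangian L \<and> (\<forall>p x. legendre_dual L (p, x) = L (- x, - p))"

(* Partially defined linear maps are total functions paired with a domain; the values outside
   the domain are irrelevant. *)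
definition linear_on_domain ::
    "'a::real_vector set \<Rightarrow> ('a \<Rightarrow> 'b::real_vector) \<Rightarrow> bool" where
  "linear_on_domain D f \<longleftrightarrow> subspace D \<and>
     (\<forall>x\<in>D. \<forall>y\<in>D. f (x + y) = f x + f y) \<and>
     (\<forall>c. \<forall>x\<in>D. f (c *\<^sub>R x) = c *\<^sub>R f x)"

(* DA and Db are the domains of A and of the pair (b1, b2). *)
definition skew_adjoint_modulo_boundary ::
    "'a::banach set \<Rightarrow> ('a \<Rightarrow> 'a dual) \<Rightarrow> 'a set \<Rightarrow>
     ('a \<Rightarrow> 'h1::{real_inner,complete_space}) \<Rightarrow> ('a \<Rightarrow> 'h2::{real_inner,complete_space}) \<Rightarrow> bool"
where
  "skew_adjoint_modulo_boundary DA A Db b1 b2 \<longleftrightarrow>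
     linear_on_domain DA A \<and> linear_on_domain Db b1 \<and> linear_on_domain Db b2 \<and>
     (let S = DA \<inter> Db in
        closure S = UNIV \<and>
        closure ({x \<in> Db. b1 x = 0 \<and> b2 x = 0} \<inter> DA) = UNIV \<and>
        closure ((\<lambda>x. (b1 x, b2 x)) ` S) = UNIV \<and>
        (\<forall>y. y \<in> S \<longleftrightarrow>
           (SUP x\<in>{x \<in> S. norm x < 1}.
              ereal (blinfun_apply (A x) y - ((norm (b1 x))\<^sup>2 + (norm (b2 x))\<^sup>2) / 2)) < \<infinity>) \<and>
        (\<forall>x\<in>S. \<forall>y\<in>S.
           blinfun_apply (A x) y =
             - blinfun_apply (A y) x + inner (b1 x) (b1 y) - inner (b2 x) (b2 y)))"

end

theory Submission
  imports Defs
begin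

text \<open>Substituting \<open>r = A x + p\<close> in the dual of the new Lagrangian \<open>M\<close>, the skew-adjointness
  relation moves \<open>A\<close> onto \<open>y \<in> S\<close> and completes the squares of the boundary terms. The squares
  vanish approximately, without affecting \<open>x\<close>, because the kernel of the boundary operators is dense
  and their image is dense; continuity of the convex locally bounded function \<open>L (\<cdot>, r)\<close> then gives
  the full dual of \<open>L\<close>. For \<open>y \<notin> S\<close> the criterion for membership in \<open>S\<close> makes the dual infinite.
  Convexity and lower semicontinuity of \<open>M\<close> are automatic, since \<open>M\<close> is a Legendre transform.\<close>

section \<open>Convexity, lower semicontinuity and continuity\<close>

lemma ereal_convex_SUP:
  assumes "\<And>i. i \<in> I \<Longrightarrow> ereal_convex (f i)"
  shows "ereal_convex (\<lambda>z. SUP i\<in>I. f i z)"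
  unfolding ereal_convex_def
proof (intro allI impI SUP_least)
  fix x y u v i assume uv: "(0::real) \<le> u" "(0::real) \<le> v" "u + v = 1" and i: "i \<in> I"
  have "f i (u *\<^sub>R x + v *\<^sub>R y) \<le> ereal u * f i x + ereal v * f i y"
    using assms[OF i] uv unfolding ereal_convex_def by blast
  also have "\<dots> \<le> ereal u * (SUP i\<in>I. f i x) + ereal v * (SUP i\<in>I. f i y)"
    using uv i by (intro add_mono ereal_mult_left_mono SUP_upper) auto
  finally show "f i (u *\<^sub>R x + v *\<^sub>R y)
      \<le> ereal u * (SUP i\<in>I. f i x) + ereal v * (SUP i\<in>I. f i y)" .
qed

lemma lower_semicontinuous_SUP:
  assumes "\<And>i. i \<in> I \<Longrightarrow> lower_semicontinuous (f i)"
  shows "lower_semicontinuous (\<lambda>z. SUP i\<in>I. f i z)"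
  unfolding lower_semicontinuous_def
proof (intro allI SUP_least)
  fix x i assume i: "i \<in> I"
  have "f i x \<le> Liminf (at x) (f i)"
    using assms[OF i] unfolding lower_semicontinuous_def by blast
  also have "\<dots> \<le> Liminf (at x) (\<lambda>z. SUP i\<in>I. f i z)"
    using i by (intro Liminf_mono always_eventually allI SUP_upper)
  finally show "f i x \<le> Liminf (at x) (\<lambda>z. SUP i\<in>I. f i z)" .
qed

text \<open>Allowing \<open>c = \<infinity>\<close> lets the supremum in
  \<open>legendre_dual\<close> run over all points: where the Lagrangian is infinite, the affine
  term is constantly \<open>-\<infinity>\<close> and the inequality is trivial.\<close>

lemma ereal_convex_affine:
  assumes "linear f" "c \<noteq> - \<infinity>"
  shows "ereal_convex (\<lambda>z. ereal (f z) - c)"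
proof (cases c)
  case (real r)
  have "f (u *\<^sub>R x + v *\<^sub>R y) - r = u * (f x - r) + v * (f y - r)" if "u + v = 1" for x y u v
  proof -
    have "f (u *\<^sub>R x + v *\<^sub>R y) - r = u * f x + v * f y - (u + v) * r"
      using assms(1) that by (simp add: linear_add linear_cmul)
    then show ?thesis by (simp add: algebra_simps)
  qed
  then show ?thesis unfolding ereal_convex_def real by simp
next
  case PInf
  then show ?thesis unfolding ereal_convex_def by simp
qed (use assms in simp)

lemma lower_semicontinuous_affine:
  assumes "continuous_on UNIV f" "c \<noteq> - \<infinity>"
  shows "lower_semicontinuous (\<lambda>z. ereal (f z) - c)"
proof (cases c)
  case (real r)
  show ?thesis unfolding lower_semicontinuous_def
  proof
    fix x
    have "((\<lambda>z. ereal (f z) - c) \<longlongrightarrow> ereal (f x) - c) (at x)"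
      using assms(1) unfolding real continuous_on_def by (auto intro!: tendsto_intros)
    then show "ereal (f x) - c \<le> Liminf (at x) (\<lambda>z. ereal (f z) - c)"
      \<comment> \<open>At an isolated point the filter is trivial and the \<open>Liminf\<close> is
        the top element; elsewhere it equals the limit.\<close>
      by (cases "at x = bot") (auto simp: lim_imp_Liminf)
  qed
next
  case PInf
  then show ?thesis unfolding lower_semicontinuous_def by simp
qed (use assms in simp)

text \<open>The duality identity writes \<open>M\<close> as a supremum of continuous affine
  functions, so regularity never has to be checked by hand.\<close>

lemma anti_selfdualI:
  fixes M :: "'a::banach \<times> 'a dual \<Rightarrow> ereal"
  assumes nm: "\<And>z. M z \<noteq> - \<infinity>" and fin: "M z0 \<noteq> \<infinity>"
    and dual: "\<And>q y. legendre_dual M (q, y) = M (- y, - q)"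
  shows "anti_selfdual M"
proof -
  \<comment> \<open>The minus sign appears because \<open>M (x, p)\<close> is the dual evaluated at
    \<open>(- p, - x)\<close>.\<close>
  define f :: "'a \<times> 'a dual \<Rightarrow> 'a \<times> 'a dual \<Rightarrow> real"
    where "f = (\<lambda>i z. - (blinfun_apply (snd z) (fst i) + blinfun_apply (snd i) (fst z)))"
  have M: "M = (\<lambda>z. SUP i\<in>UNIV. ereal (f i z) - M i)"
  proof
    fix z
    have "M z = legendre_dual M (- snd z, - fst z)" by (simp add: dual)
    then show "M z = (SUP i\<in>UNIV. ereal (f i z) - M i)"
      unfolding legendre_dual_def f_def case_prod_beta
      by (simp add: blinfun.minus_left blinfun.minus_right)
  qed
  have "linear (f i)" for i
    by (rule linearI)
      (simp_all add: f_def blinfun.add_left blinfun.add_right blinfun.scaleR_left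
        blinfun.scaleR_right algebra_simps)
  then have "ereal_convex M"
    by (subst M) (intro ereal_convex_SUP ereal_convex_affine nm)
  moreover have "continuous_on UNIV (f i)" for i
    unfolding f_def by (intro continuous_intros)
  then have "lower_semicontinuous M"
    by (subst M) (intro lower_semicontinuous_SUP lower_semicontinuous_affine nm)
  ultimately show ?thesis
    using nm fin dual unfolding anti_selfdual_def convex_lagrangian_def by blast
qed

text \<open>A convex function that is bounded on a ball is continuous there. This makes it possible
  to perturb \<open>x\<close> while the dual variable stays fixed.\<close>

lemma convex_bounded_imp_continuous:
  fixes L :: "'a::real_normed_vector \<times> 'b::real_vector \<Rightarrow> real"
  assumes conv: "ereal_convex (\<lambda>z. ereal (L z))"
    and bdd: "\<And>B. bounded B \<Longrightarrow> bounded ((\<lambda>x. L (x, p)) ` B)"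
  shows "continuous_on UNIV (\<lambda>x. L (x, p))"
proof -
  have cv: "convex_on UNIV (\<lambda>x. L (x, p))"
  proof (intro convex_onI)
    fix t x y assume t: "0 < t" "t < (1::real)"
    have "ereal (L ((1 - t) *\<^sub>R (x, p) + t *\<^sub>R (y, p)))
        \<le> ereal (1 - t) * ereal (L (x, p)) + ereal t * ereal (L (y, p))"
      using conv t unfolding ereal_convex_def by (smt (verit))
    then show "L ((1 - t) *\<^sub>R x + t *\<^sub>R y, p) \<le> (1 - t) * L (x, p) + t * L (y, p)"
      \<comment> \<open>The second coordinate collapses, as \<open>(1 - t) + t = 1\<close>.\<close>
      by (simp flip: scaleR_left_distrib)
  qed simp
  show ?thesis
  proof (subst continuous_on_eq_continuous_at)
    show "\<forall>x\<in>UNIV. isCont (\<lambda>x. L (x, p)) x"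
    proof
      fix x :: 'a
      obtain b where "\<And>y. y \<in> ball x 1 \<Longrightarrow> \<bar>L (y, p)\<bar> \<le> b"
        using bdd[OF bounded_ball, of x 1] unfolding bounded_iff by fastforce
      moreover have "convex_on (ball x 1) (\<lambda>x. L (x, p))"
        using cv by (rule convex_on_subset) auto
      ultimately have "continuous_on (ball x 1) (\<lambda>x. L (x, p))"
        by (intro convex_on_bounded_continuous) auto
      then show "isCont (\<lambda>x. L (x, p)) x"
        by (simp add: continuous_on_eq_continuous_at)
    qed
  qed simp
qed

section \<open>The dual of the Lagrangian with boundary terms\<close>

theorem proposition2p1:
  fixes L :: "'a::banach \<times> 'a dual \<Rightarrow> real"
    and A :: "'a \<Rightarrow> 'a dual"
    and b1 :: "'a \<Rightarrow> 'h1::{real_inner,complete_space}"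
    and b2 :: "'a \<Rightarrow> 'h2::{real_inner,complete_space}"
    and DA Db :: "'a set"
  assumes "reflexive_space TYPE('a)"
    and "anti_selfdual (\<lambda>z. ereal (L z))"
    and "\<And>p B. bounded B \<Longrightarrow> bounded ((\<lambda>x. L (x, p)) ` B)"
    and "skew_adjoint_modulo_boundary DA A Db b1 b2"
  shows "anti_selfdual (\<lambda>(x, p).
           if x \<in> DA \<inter> Db
           then ereal (L (x, A x + p) + (norm (b1 x))\<^sup>2 / 2 + (norm (b2 x))\<^sup>2 / 2)
           else \<infinity>)"
proof -
  define S where "S = DA \<inter> Db"
  define M where "M = (\<lambda>(x, p).
           if x \<in> S
           then ereal (L (x, A x + p) + (norm (b1 x))\<^sup>2 / 2 + (norm (b2 x))\<^sup>2 / 2)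
           else \<infinity>)"
  have linA: "linear_on_domain DA A" and lin1: "linear_on_domain Db b1"
    and lin2: "linear_on_domain Db b2"
    and ker: "closure ({x \<in> Db. b1 x = 0 \<and> b2 x = 0} \<inter> DA) = UNIV"
    and im: "closure ((\<lambda>x. (b1 x, b2 x)) ` S) = UNIV"
    and mem: "\<And>y. y \<in> S \<longleftrightarrow>
           (SUP x\<in>{x \<in> S. norm x < 1}.
              ereal (blinfun_apply (A x) y - ((norm (b1 x))\<^sup>2 + (norm (b2 x))\<^sup>2) / 2)) < \<infinity>"
    and skew: "\<And>x y. x \<in> S \<Longrightarrow> y \<in> S \<Longrightarrow>
           blinfun_apply (A x) y =
             - blinfun_apply (A y) x + inner (b1 x) (b1 y) - inner (b2 x) (b2 y)"
    using assms(4) unfolding skew_adjoint_modulo_boundary_def Let_def S_def[symmetric] by blast+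
  have subS: "subspace S"
    using linA lin1 unfolding S_def linear_on_domain_def by (simp add: subspace_inter)
  have negS: "- x \<in> S \<longleftrightarrow> x \<in> S" for x
    using subspace_neg[OF subS, of x] subspace_neg[OF subS, of "- x"] by auto
  have neg: "A (- x) = - A x" "b1 (- x) = - b1 x" "b2 (- x) = - b2 x" if "x \<in> S" for x
  proof -
    have "x \<in> DA" "x \<in> Db" using that by (auto simp: S_def)
    then have "A ((- 1) *\<^sub>R x) = (- 1) *\<^sub>R A x" "b1 ((- 1) *\<^sub>R x) = (- 1) *\<^sub>R b1 x"
      "b2 ((- 1) *\<^sub>R x) = (- 1) *\<^sub>R b2 x"
      using linA lin1 lin2 unfolding linear_on_domain_def by blast+
    then show "A (- x) = - A x" "b1 (- x) = - b1 x" "b2 (- x) = - b2 x" by simp_all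
  qed
  have contL: "continuous_on UNIV (\<lambda>x. L (x, p))" for p
    using assms(2,3) unfolding anti_selfdual_def convex_lagrangian_def
    by (intro convex_bounded_imp_continuous) auto
  have dualL: "legendre_dual (\<lambda>z. ereal (L z)) (q, y) = ereal (L (- y, - q))" for q y
    using assms(2) unfolding anti_selfdual_def by blast

  \<comment> \<open>The competitor \<open>(x, r - A x)\<close> cancels the shift by
    \<open>A x\<close> inside \<open>M\<close>, which leaves \<open>r\<close> free.\<close>
  have lower: "ereal (blinfun_apply q x + blinfun_apply r y - blinfun_apply (A x) y - L (x, r)
      - (norm (b1 x))\<^sup>2 / 2 - (norm (b2 x))\<^sup>2 / 2) \<le> legendre_dual M (q, y)"
    if "x \<in> S" for q y x r
    unfolding legendre_dual_def prod.case using that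
    by (intro SUP_upper2[of "(x, r - A x)"]) (auto simp: M_def blinfun.diff_left)

  \<comment> \<open>Skewness replaces \<open>- A x\<close> paired with \<open>y\<close> by
    \<open>A y\<close> paired with \<open>x\<close> plus inner products of boundary values. Opposite
    signs of these products produce the sum for \<open>b1\<close> and the difference for
    \<open>b2\<close>; the leftover squares of \<open>y\<close> are the boundary terms of
    \<open>M (- y, - q)\<close>.\<close>
  have square: "blinfun_apply q x + blinfun_apply r y - blinfun_apply (A x) y - L (x, r)
        - (norm (b1 x))\<^sup>2 / 2 - (norm (b2 x))\<^sup>2 / 2
      = blinfun_apply (q + A y) x + blinfun_apply r y - L (x, r)
        - (norm (b1 x + b1 y))\<^sup>2 / 2 - (norm (b2 x - b2 y))\<^sup>2 / 2
        + (norm (b1 y))\<^sup>2 / 2 + (norm (b2 y))\<^sup>2 / 2"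
    if "x \<in> S" "y \<in> S" for q x r y
    using skew[OF that]
    by (simp add: power2_norm_eq_inner inner_add_left inner_add_right inner_diff_left
        inner_diff_right inner_commute blinfun.add_left field_simps)

  \<comment> \<open>Dropping the two nonpositive square terms leaves a term of the dual of
    \<open>L\<close> at \<open>(q + A y, y)\<close>, whose value is known by
    anti-selfduality.\<close>
  have le: "legendre_dual M (q, y) \<le> M (- y, - q)" if y: "y \<in> S" for q y
    unfolding legendre_dual_def prod.case
  proof (intro SUP_least, clarify)
    fix x p
    show "ereal (blinfun_apply q x + blinfun_apply p y) - M (x, p) \<le> M (- y, - q)"
    proof (cases "x \<in> S")
      case True
      define r where "r = A x + p"
      have "ereal (blinfun_apply (q + A y) x + blinfun_apply r y) - ereal (L (x, r))
          \<le> legendre_dual (\<lambda>z. ereal (L z)) (q + A y, y)"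
        unfolding legendre_dual_def prod.case by (intro SUP_upper2[of "(x, r)"]) auto
      then have "blinfun_apply (q + A y) x + blinfun_apply r y - L (x, r) \<le> L (- y, - q - A y)"
        by (simp add: dualL)
      moreover have "0 \<le> (norm (b1 x + b1 y))\<^sup>2" "0 \<le> (norm (b2 x - b2 y))\<^sup>2" by simp_all
      moreover have "blinfun_apply p y = blinfun_apply r y - blinfun_apply (A x) y"
        by (simp add: r_def blinfun.add_left)
      ultimately have "blinfun_apply q x + blinfun_apply p y
            - (L (x, r) + (norm (b1 x))\<^sup>2 / 2 + (norm (b2 x))\<^sup>2 / 2)
          \<le> L (- y, - q - A y) + (norm (b1 y))\<^sup>2 / 2 + (norm (b2 y))\<^sup>2 / 2"
        using square[OF True y, of q r] by linarith
      then show ?thesis using True y by (simp add: M_def r_def negS neg)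
    qed (simp add: M_def)
  qed

  have ge: "M (- y, - q) \<le> legendre_dual M (q, y)" if y: "y \<in> S" for q y
  proof -
    define c where "c = (norm (b1 y))\<^sup>2 / 2 + (norm (b2 y))\<^sup>2 / 2"
    \<comment> \<open>Here \<open>x\<close> is arbitrary in the whole space and the squares are
      gone; both are achieved by a limit of points of \<open>S\<close>.\<close>
    have key: "ereal (blinfun_apply (q + A y) x + blinfun_apply r y - L (x, r) + c)
        \<le> legendre_dual M (q, y)" for x r
    proof -
      \<comment> \<open>This is the boundary value at which both squares vanish.\<close>
      have "(- b1 y, b2 y) \<in> closure ((\<lambda>x. (b1 x, b2 x)) ` S)" by (simp add: im)
      then obtain g where g: "\<And>n. g n \<in> (\<lambda>x. (b1 x, b2 x)) ` S" "g \<longlonglongrightarrow> (- b1 y, b2 y)"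
        unfolding closure_sequential by blast
      then obtain u where u: "\<And>n. u n \<in> S" "\<And>n. g n = (b1 (u n), b2 (u n))"
        unfolding image_iff by metis
      \<comment> \<open>The sequence \<open>u\<close> need not converge. Adding kernel elements
        close to \<open>x - u n\<close> forces convergence to \<open>x\<close> without altering the
        boundary values.\<close>
      have "\<exists>z \<in> {x \<in> Db. b1 x = 0 \<and> b2 x = 0} \<inter> DA. dist z (x - u n) < inverse (Suc n)" for n
        using closure_approachable[of "x - u n", THEN iffD1, rule_format] ker by simp
      then obtain z where z: "\<And>n. z n \<in> {x \<in> Db. b1 x = 0 \<and> b2 x = 0} \<inter> DA"
        and zd: "\<And>n. dist (z n) (x - u n) < inverse (Suc n)" by metis
      define w where "w n = u n + z n" for n
      have wS: "w n \<in> S" for n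
        using subspace_add[OF subS u(1)[of n], of "z n"] z[of n] by (auto simp: w_def S_def)
      have bw: "b1 (w n) = b1 (u n)" "b2 (w n) = b2 (u n)" for n
        using z[of n] u(1)[of n] lin1 lin2 unfolding w_def S_def linear_on_domain_def by auto
      have "dist (w n) x \<le> inverse (real (Suc n))" for n
        using less_imp_le[OF zd[of n]] by (simp add: w_def dist_norm algebra_simps)
      then have "(\<lambda>n. dist (w n) x) \<longlonglongrightarrow> 0"
        by (intro tendsto_sandwich[OF _ _ tendsto_const LIMSEQ_inverse_real_of_nat]) auto
      then have wx: "w \<longlonglongrightarrow> x"
        by (rule iffD2[OF tendsto_dist_iff])
      have "(\<lambda>n. b1 (w n)) \<longlonglongrightarrow> - b1 y" "(\<lambda>n. b2 (w n)) \<longlonglongrightarrow> b2 y"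
        using tendsto_fst[OF g(2)] tendsto_snd[OF g(2)] by (simp_all add: u(2) bw)
      moreover have "(\<lambda>n. L (w n, r)) \<longlonglongrightarrow> L (x, r)"
        using continuous_on_tendsto_compose[OF contL wx, of r] by simp
      ultimately have "(\<lambda>n. blinfun_apply (q + A y) (w n) + blinfun_apply r y - L (w n, r)
          - (norm (b1 (w n) + b1 y))\<^sup>2 / 2 - (norm (b2 (w n) - b2 y))\<^sup>2 / 2 + c)
        \<longlonglongrightarrow> blinfun_apply (q + A y) x + blinfun_apply r y - L (x, r)
          - (norm (- b1 y + b1 y))\<^sup>2 / 2 - (norm (b2 y - b2 y))\<^sup>2 / 2 + c"
        using wx by (intro tendsto_intros) auto
      then have "(\<lambda>n. ereal (blinfun_apply (q + A y) (w n) + blinfun_apply r y - L (w n, r)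
          - (norm (b1 (w n) + b1 y))\<^sup>2 / 2 - (norm (b2 (w n) - b2 y))\<^sup>2 / 2 + c))
        \<longlonglongrightarrow> ereal (blinfun_apply (q + A y) x + blinfun_apply r y - L (x, r) + c)"
        by (intro tendsto_ereal) simp
      moreover have "ereal (blinfun_apply (q + A y) (w n) + blinfun_apply r y - L (w n, r)
          - (norm (b1 (w n) + b1 y))\<^sup>2 / 2 - (norm (b2 (w n) - b2 y))\<^sup>2 / 2 + c)
          \<le> legendre_dual M (q, y)" for n
        using lower[OF wS[of n], of q r y] unfolding square[OF wS[of n] y] c_def
        by (simp add: add.assoc)
      ultimately show ?thesis using LIMSEQ_le_const2 by blast
    qed
    have "ereal (L (- y, - q - A y)) = legendre_dual (\<lambda>z. ereal (L z)) (q + A y, y)"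
      by (simp add: dualL)
    \<comment> \<open>The real constant \<open>c\<close> is moved across so that \<open>key\<close>
      bounds every term of the supremum.\<close>
    also have "\<dots> \<le> legendre_dual M (q, y) - ereal c"
      unfolding legendre_dual_def[of "\<lambda>z. ereal (L z)"] prod.case
    proof (intro SUP_least, clarify)
      fix x r
      show "ereal (blinfun_apply (q + A y) x + blinfun_apply r y) - ereal (L (x, r))
          \<le> legendre_dual M (q, y) - ereal c"
        using key[of x r] by (simp add: ereal_le_minus)
    qed
    finally have "ereal (L (- y, - q - A y) + c) \<le> legendre_dual M (q, y)"
      by (simp add: ereal_le_minus)
    then show ?thesis using y by (simp add: M_def negS neg c_def add.assoc)
  qed

  have infinite: "legendre_dual M (q, y) = \<infinity>" if y: "y \<notin> S" for q y
  proof -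
    \<comment> \<open>Taking \<open>r = 0\<close> in \<open>lower\<close>, the terms with
      \<open>q\<close> and \<open>L\<close> are bounded on the unit ball, so only the expression in
      the membership criterion can be unbounded.\<close>
    obtain C where C: "\<And>x. norm x < 1 \<Longrightarrow> \<bar>L (x, 0)\<bar> \<le> C"
      using assms(3)[OF bounded_ball[of 0 1], of 0] unfolding bounded_iff by fastforce
    have "(SUP x\<in>{x \<in> S. norm x < 1}.
              ereal (blinfun_apply (A x) y - ((norm (b1 x))\<^sup>2 + (norm (b2 x))\<^sup>2) / 2))
          \<le> legendre_dual M (q, y) + ereal (norm q + C)"
    proof (intro SUP_least, clarify)
      fix x assume x: "x \<in> S" "norm x < 1"
      have "\<bar>blinfun_apply q (- x)\<bar> \<le> norm q * norm (- x)"
        using norm_blinfun[of q "- x"] by simp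
      also have "\<dots> \<le> norm q" using x(2) by (simp add: mult_left_le)
      finally have "\<bar>blinfun_apply q (- x)\<bar> \<le> norm q" .
      moreover have "\<bar>L (- x, 0)\<bar> \<le> C" using x by (intro C) simp
      \<comment> \<open>Testing at \<open>- x\<close> gives \<open>A x\<close> the sign it has in
        the criterion; the norms of the boundary values do not change.\<close>
      ultimately have "ereal (blinfun_apply (A x) y - ((norm (b1 x))\<^sup>2 + (norm (b2 x))\<^sup>2) / 2)
        \<le> ereal (blinfun_apply q (- x) + blinfun_apply 0 y - blinfun_apply (A (- x)) y - L (- x, 0)
          - (norm (b1 (- x)))\<^sup>2 / 2 - (norm (b2 (- x)))\<^sup>2 / 2) + ereal (norm q + C)"
        using x by (simp add: neg blinfun.minus_left add_divide_distrib)
      also have "\<dots> \<le> legendre_dual M (q, y) + ereal (norm q + C)"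
        using x by (intro add_right_mono lower) (simp add: negS)
      finally show "ereal (blinfun_apply (A x) y - ((norm (b1 x))\<^sup>2 + (norm (b2 x))\<^sup>2) / 2)
        \<le> legendre_dual M (q, y) + ereal (norm q + C)" .
    qed
    moreover have "(SUP x\<in>{x \<in> S. norm x < 1}.
              ereal (blinfun_apply (A x) y - ((norm (b1 x))\<^sup>2 + (norm (b2 x))\<^sup>2) / 2)) = \<infinity>"
      using mem[of y] y by (simp add: less_top)
    ultimately show ?thesis by (cases "legendre_dual M (q, y)") auto
  qed

  have "anti_selfdual M"
  proof (rule anti_selfdualI)
    show "M z \<noteq> - \<infinity>" for z by (cases z) (simp add: M_def)
    show "M (0, 0) \<noteq> \<infinity>" using subspace_0[OF subS] by (simp add: M_def)
    show "legendre_dual M (q, y) = M (- y, - q)" for q y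
    proof (cases "y \<in> S")
      case True
      then show ?thesis using le ge by (intro antisym)
    next
      case False
      then show ?thesis using infinite by (simp add: M_def negS)
    qed
  qed
  then show ?thesis unfolding M_def S_def .
qed

end
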